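(* Let $\Gamma$ be a finite simple graph whose edges are each colored with exactly one color from $C = \{1,\dots,6\}$, and for $i \in C$ let $C_i$ be the number of edges of color $i$. Fix a rainbow $6$-edge-coloring of $K_4$ (each of the six edges of $K_4$ gets a distinct color from $C$), and let $H$ be the number of copies of $K_4$ in $\Gamma$ whose edge-coloring is this fixed rainbow coloring. Then $H \le \sqrt[3]{\prod_{i=1}^6 C_i}$.
   Context: A copy of $K_4$ with the fixed coloring means a set of four pairwise adjacent vertices of $\Gamma$ such that the induced edge-colored $K_4$ is isomorphic (as an edge-colored graph, with colors preserved) to the fixed rainbow-colored $K_4$. *)

theory Defs
  imports Complex_Main "HOL-Library.Ramsey"
begin

text \<open>
  Graphs are given by a vertex set and a set of edges, where an edge is a two-element set of
  vertices. The set \<^term>\<open>nsets V k\<close> consists of the \<^term>\<open>k\<close>-element subsets of \<^term>\<open>V\<close>.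
\<close>

definition finite_simple_graph :: "'a set \<Rightarrow> 'a set set \<Rightarrow> bool" where
  "finite_simple_graph V E \<longleftrightarrow> finite V \<and> E \<subseteq> nsets V 2"

definition colors :: "nat set" where
  "colors = {1..6}"

text \<open>A colouring is a total function on vertex sets; only its values on edges matter.\<close>

definition edge_coloring :: "'a set set \<Rightarrow> ('a set \<Rightarrow> nat) \<Rightarrow> bool" where
  "edge_coloring E c \<longleftrightarrow> (\<forall>e\<in>E. c e \<in> colors)"

definition rainbow_coloring :: "'a set set \<Rightarrow> ('a set \<Rightarrow> nat) \<Rightarrow> bool" where
  "rainbow_coloring E c \<longleftrightarrow> edge_coloring E c \<and> inj_on c E"

definition color_count :: "'a set set \<Rightarrow> ('a set \<Rightarrow> nat) \<Rightarrow> nat \<Rightarrow> nat" where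
  "color_count E c i = card {e \<in> E. c e = i}"

definition K4_verts :: "nat set" where
  "K4_verts = {1..4}"

definition K4_edges :: "nat set set" where
  "K4_edges = nsets K4_verts 2"

definition induced_edges :: "'a set set \<Rightarrow> 'a set \<Rightarrow> 'a set set" where
  "induced_edges E S = {e \<in> E. e \<subseteq> S}"

definition colored_graph_iso ::
  "'a set \<Rightarrow> 'a set set \<Rightarrow> ('a set \<Rightarrow> nat) \<Rightarrow>
   'b set \<Rightarrow> 'b set set \<Rightarrow> ('b set \<Rightarrow> nat) \<Rightarrow> ('a \<Rightarrow> 'b) \<Rightarrow> bool" where
  "colored_graph_iso V E c V' E' c' f \<longleftrightarrow>
     bij_betw f V V' \<and>
     (\<forall>e \<in> nsets V 2. e \<in> E \<longleftrightarrow> f ` e \<in> E') \<and>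
     (\<forall>e \<in> E. c' (f ` e) = c e)"

text \<open>
  A copy is a vertex set, so it is counted once, however many isomorphisms witness it.
\<close>

definition K4_copies ::
  "'a set \<Rightarrow> 'a set set \<Rightarrow> ('a set \<Rightarrow> nat) \<Rightarrow> (nat set \<Rightarrow> nat) \<Rightarrow> 'a set set" where
  "K4_copies V E c r =
     {S \<in> nsets V 4.
        (\<forall>u\<in>S. \<forall>v\<in>S. u \<noteq> v \<longrightarrow> {u, v} \<in> E) \<and>
        (\<exists>f. colored_graph_iso K4_verts K4_edges r S (induced_edges E S) c f)}"

end

theory Submission
  imports Defs
begin

text \<open>
  Two opposite edges of a copy of \<open>K\<^sub>4\<close> cover its four vertices, so a copy, being a vertex set, is
  the union of its two edges with any given pair of opposite colours. Hence the number of copies is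
  at most the product of the two colour counts, for each of the three perfect matchings of
  \<open>K\<^sub>4\<close>; the bound is the geometric mean of these three inequalities.
\<close>

lemma card_K4_copies_le_opposite:
  assumes fin: "finite E"
    and AB: "A \<in> K4_edges" "B \<in> K4_edges" "A \<union> B = K4_verts"
  shows "card (K4_copies V E c r) \<le> color_count E c (r A) * color_count E c (r B)"
proof -
  define F where "F i = {e \<in> E. c e = i}" for i
  have fF: "finite (F i)" for i
    using fin by (simp add: F_def)
  \<comment> \<open>Mapping pairs of edges onto copies, rather than copies to pairs, avoids choosing
    an isomorphism for each copy; unions that are not copies do no harm.\<close>
  have "K4_copies V E c r \<subseteq> (\<lambda>(e, e'). e \<union> e') ` (F (r A) \<times> F (r B))"
  proof
    fix S assume "S \<in> K4_copies V E c r"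
    then obtain f where f: "colored_graph_iso K4_verts K4_edges r S (induced_edges E S) c f"
      by (auto simp: K4_copies_def)
    have "f ` X \<in> F (r X)" if "X \<in> K4_edges" for X
      using f that
      by (auto simp: colored_graph_iso_def F_def induced_edges_def K4_edges_def)
    with AB have "f ` A \<in> F (r A)" "f ` B \<in> F (r B)"
      by auto
    moreover have "S = f ` A \<union> f ` B"
      using f AB(3) by (auto simp: colored_graph_iso_def bij_betw_def simp flip: image_Un)
    ultimately show "S \<in> (\<lambda>(e, e'). e \<union> e') ` (F (r A) \<times> F (r B))"
      by force
  qed
  then have "card (K4_copies V E c r) \<le> card (F (r A) \<times> F (r B))"
    using fF by (intro surj_card_le) auto
  then show ?thesis
    by (simp add: color_count_def F_def card_cartesian_product)
qed

lemma K4_verts_eq: "K4_verts = {1,2,3,4}"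
  by (auto simp: K4_verts_def)

lemma card_K4_edges: "card K4_edges = 6"
  by (simp add: K4_edges_def K4_verts_def card_nsets choose_two)

text \<open>Six distinct members exhaust a set of cardinality 6. They are listed as consecutive
  pairs of opposite edges, one pair for each perfect matching.\<close>

lemma K4_edges_eq: "K4_edges = {{1,2}, {3,4}, {1,3}, {2,4}, {1,4}, {2,3}}"
proof -
  have "{{1,2}, {3,4}, {1,3}, {2,4}, {1,4}, {2,3}} \<subseteq> K4_edges"
    by (simp add: K4_edges_def K4_verts_eq nsets_def)
  moreover have "card {{1,2}, {3,4}, {1,3}, {2,4}, {1,4}, {2,3::nat}} = 6"
    by (simp add: doubleton_eq_iff)
  \<comment> \<open>An infinite set has \<open>card\<close> 0, so cardinality 6 forces
    finiteness.\<close>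
  moreover have "finite K4_edges"
    by (rule card_ge_0_finite) (simp add: card_K4_edges)
  ultimately show ?thesis
    by (metis card_K4_edges card_subset_eq)
qed

text \<open>An injection into a finite set of the same size is onto. This lets a product over the
  edges of the fixed \<open>K4\<close> be reindexed by the colors.\<close>

lemma bij_betw_rainbow_K4_coloring:
  assumes "rainbow_coloring K4_edges r"
  shows "bij_betw r K4_edges colors"
proof -
  have "inj_on r K4_edges" "r ` K4_edges \<subseteq> colors"
    using assms by (auto simp: rainbow_coloring_def edge_coloring_def)
  moreover have "card K4_edges = card colors"
    by (simp add: card_K4_edges colors_def)
  ultimately show ?thesis
    by (simp add: bij_betw_def card_image card_subset_eq colors_def)
qed

theorem theorem1p4:
  fixes V :: "'a set" and E :: "'a set set" and c :: "'a set \<Rightarrow> nat"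
    and r :: "nat set \<Rightarrow> nat"
  assumes "finite_simple_graph V E"
    and "edge_coloring E c"
    and "rainbow_coloring K4_edges r"
  shows "real (card (K4_copies V E c r)) \<le> root 3 (\<Prod>i\<in>colors. real (color_count E c i))"
proof -
  let ?H = "card (K4_copies V E c r)"
  let ?C = "\<lambda>e. color_count E c (r e)"
  have fin: "finite E"
    using assms(1) by (auto simp: finite_simple_graph_def intro: finite_subset finite_imp_finite_nsets)
  note le = card_K4_copies_le_opposite[OF fin, of _ _ V c r]
  have 1: "?H \<le> ?C {1,2} * ?C {3,4}" "?H \<le> ?C {1,3} * ?C {2,4}" "?H \<le> ?C {1,4} * ?C {2,3}"
    by (rule le; simp add: K4_edges_eq K4_verts_eq insert_commute)+
  \<comment> \<open>Each of the three factors is bounded through a different perfect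
    matching.\<close>
  have "?H ^ 3 = ?H * (?H * ?H)"
    by (simp add: power3_eq_cube)
  also have "\<dots> \<le> (?C {1,2} * ?C {3,4}) * ((?C {1,3} * ?C {2,4}) * (?C {1,4} * ?C {2,3}))"
    by (intro mult_le_mono 1)
  \<comment> \<open>The three matchings partition the six edges, so each edge contributes exactly
    one factor.\<close>
  also have "\<dots> = (\<Prod>e\<in>K4_edges. ?C e)"
    by (simp add: K4_edges_eq doubleton_eq_iff)
  also have "\<dots> = (\<Prod>i\<in>colors. color_count E c i)"
    by (rule prod.reindex_bij_betw[OF bij_betw_rainbow_K4_coloring[OF assms(3)]])
  finally have "real ?H ^ 3 \<le> (\<Prod>i\<in>colors. real (color_count E c i))"
    by (simp flip: of_nat_power of_nat_prod)
  then have "root 3 (real ?H ^ 3) \<le> root 3 (\<Prod>i\<in>colors. real (color_count E c i))"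
    by simp
  then show ?thesis
    by (simp add: real_root_power_cancel)
qed

end
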